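(* Let $a\in[0,1)$. If $f\in L^2([0,1])$ has Fourier expansion $$f(x)=\sum_{k=-\infty}^{\infty}\alpha_k e_k(x),$$ then it has the Weierstrass Fourier expansion $$f(x)=\sum_{k=-\infty}^{\infty}\tilde\alpha_k\tilde e_k(x),$$ both expansions being understood as convergent in $L^2([0,1])$. In particular, when $a=0$, the two expansions are the same (that is, $\tilde\alpha_k=\alpha_k$ and $\tilde e_k=e_k$ for all $k\in\mathbb{Z}$).
   Context: $L^2([0,1])$ is the space of complex-valued square-integrable functions on $[0,1]$ with inner product $\langle f,g\rangle=\int_0^1 f(x)\overline{g(x)}\,dx$. For $k\in\mathbb{Z}$, $e_k(x)=e^{2\pi i k x}$ and $\alpha_k=\langle f,e_k\rangle$ is the $k$-th Fourier coefficient of $f$. For a fixed real $a\in[0,1)$ and $k\in\mathbb{Z}$ (with $a^0=1$, also when $a=0$), $$\tilde e_k(x)=\begin{cases}1 & \text{if } k=0,\\ \sqrt{1-a^2}\,\sum_{m=0}^{\infty}a^m e^{2\pi i k 2^m x} & \text{if } k \text{ is odd},\\ (1-a^2)\sum_{m=0}^{\infty}a^m e^{2\pi i k 2^m x}-a\,e^{\pi i k x} & \text{if } k \text{ is even and } k\neq 0.\end{cases}$$ The Weierstrass Fourier coefficients of $f$ are $\tilde\alpha_k=\langle f,\tilde e_k\rangle$, given in terms of the Fourier coefficients by $$\tilde\alpha_k=\begin{cases}\alpha_0 & \text{if } k=0,\\ \sqrt{1-a^2}\,\sum_{m=0}^{\infty}a^m\alpha_{k 2^m} & \text{if } k \text{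 is odd},\\ (1-a^2)\sum_{m=0}^{\infty}a^m\alpha_{k 2^m}-a\,\alpha_{k/2} & \text{if } k \text{ is even and } k\neq 0.\end{cases}$$ *)

theory Defs
  imports "HOL-Analysis.Analysis"
begin

text \<open>
  Elements of $L^2([0,1])$ are represented by functions on the real line, of which only the
  restriction to $[0,1]$, up to null sets, matters.
\<close>

definition L2_unit :: "(real \<Rightarrow> complex) set" where
  "L2_unit = {f. f \<in> borel_measurable (lebesgue_on {0..1}) \<and>
                 integrable (lebesgue_on {0..1}) (\<lambda>x. (norm (f x))\<^sup>2)}"

definition L2_inner :: "(real \<Rightarrow> complex) \<Rightarrow> (real \<Rightarrow> complex) \<Rightarrow> complex" where
  "L2_inner f g = (\<integral>x. f x * cnj (g x) \<partial>(lebesgue_on {0..1}))"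

definition L2_norm :: "(real \<Rightarrow> complex) \<Rightarrow> real" where
  "L2_norm f = sqrt (\<integral>x. (norm (f x))\<^sup>2 \<partial>(lebesgue_on {0..1}))"

text \<open>
  The two-sided series with terms \<open>c k * u k\<close> converges to \<open>f\<close> in $L^2([0,1])$: the partial
  sums over \<open>-M \<le> k \<le> N\<close> converge in norm as \<open>M\<close> and \<open>N\<close> tend to infinity
  independently.  The Bochner integral of a non-integrable function is 0, so all the functions
  involved are required to be square-integrable.
\<close>

definition has_L2_expansion ::
    "(real \<Rightarrow> complex) \<Rightarrow> (int \<Rightarrow> complex) \<Rightarrow> (int \<Rightarrow> real \<Rightarrow> complex) \<Rightarrow> bool" where
  "has_L2_expansion f c u \<longleftrightarrow>
     f \<in> L2_unit \<and> (\<forall>k. u k \<in> L2_unit) \<and>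
     ((\<lambda>(M, N). L2_norm (\<lambda>x. f x - (\<Sum>k = - int M..int N. c k * u k x))) \<longlongrightarrow> 0)
       (sequentially \<times>\<^sub>F sequentially)"

definition fourier_exp :: "int \<Rightarrow> real \<Rightarrow> complex" where
  "fourier_exp k x = exp (2 * of_real pi * \<i> * of_int k * of_real x)"

definition fourier_coeff :: "(real \<Rightarrow> complex) \<Rightarrow> int \<Rightarrow> complex" where
  "fourier_coeff f k = L2_inner f (fourier_exp k)"

definition weierstrass_exp :: "real \<Rightarrow> int \<Rightarrow> real \<Rightarrow> complex" where
  "weierstrass_exp a k x =
     (if k = 0 then 1
      else if odd k then
        of_real (sqrt (1 - a\<^sup>2)) *
          (\<Sum>m. of_real a ^ m * exp (2 * of_real pi * \<i> * of_int k * 2 ^ m * of_real x))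
      else
        of_real (1 - a\<^sup>2) *
          (\<Sum>m. of_real a ^ m * exp (2 * of_real pi * \<i> * of_int k * 2 ^ m * of_real x))
        - of_real a * exp (of_real pi * \<i> * of_int k * of_real x))"

definition weierstrass_coeff :: "real \<Rightarrow> (real \<Rightarrow> complex) \<Rightarrow> int \<Rightarrow> complex" where
  "weierstrass_coeff a f k = L2_inner f (weierstrass_exp a k)"

end

theory Submission
  imports Defs
begin

text \<open>
  Write \<open>w k\<close> for the lacunary series \<open>\<Sum>m. a ^ m * e (k * 2 ^ m)\<close>, so that
  \<open>w k = e k + a * w (2 * k)\<close>.  The Weierstrass exponential of index \<open>k\<close> is then
  \<open>sqrt (1 - a\<^sup>2) * w k\<close> for odd \<open>k\<close> and \<open>w k - a * w (k / 2)\<close> for even \<open>k \<noteq> 0\<close>: it is the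
  Gram--Schmidt orthonormalisation of \<open>w\<close> along each chain \<open>k, 2 * k, 4 * k, \<dots>\<close> with \<open>k\<close> odd.
  Moreover each \<open>e k\<close> is a finite combination of Weierstrass exponentials of
  indices \<open>j\<close> with \<open>\<bar>j\<bar> \<le> 2 * \<bar>k\<bar>\<close>, so the best-approximation property of
  orthogonal projections transfers the convergence of the Fourier series.
\<close>

section \<open>The inner product on square-integrable functions\<close>

abbreviation U :: "real measure" where "U \<equiv> lebesgue_on {0..1}"

lemma L2_unitD:
  assumes "f \<in> L2_unit"
  shows "f \<in> borel_measurable U" "integrable U (\<lambda>x. (norm (f x))\<^sup>2)"
  using assms by (auto simp: L2_unit_def)

lemma L2_unit_cmult:
  assumes "f \<in> L2_unit"
  shows "(\<lambda>x. c * f x) \<in> L2_unit"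
  using L2_unitD[OF assms] by (auto simp: L2_unit_def norm_mult power_mult_distrib)

lemma L2_unit_add:
  assumes "f \<in> L2_unit" "g \<in> L2_unit"
  shows "(\<lambda>x. f x + g x) \<in> L2_unit"
proof -
  note [measurable] = L2_unitD(1)[OF assms(1)] L2_unitD(1)[OF assms(2)]
  have "integrable U (\<lambda>x. (norm (f x + g x))\<^sup>2)"
  proof (rule Bochner_Integration.integrable_bound)
    show "integrable U (\<lambda>x. 2 * ((norm (f x))\<^sup>2 + (norm (g x))\<^sup>2))"
      using L2_unitD(2)[OF assms(1)] L2_unitD(2)[OF assms(2)] by simp
    have "(norm (f x + g x))\<^sup>2 \<le> 2 * ((norm (f x))\<^sup>2 + (norm (g x))\<^sup>2)" for x
    proof -
      have "(norm (f x + g x))\<^sup>2 \<le> (norm (f x) + norm (g x))\<^sup>2"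
        by (intro power_mono norm_triangle_ineq) auto
      also have "\<dots> \<le> 2 * ((norm (f x))\<^sup>2 + (norm (g x))\<^sup>2)"
        using sum_squares_bound[of "norm (f x)" "norm (g x)"] by (simp add: power2_sum)
      finally show ?thesis .
    qed
    then show "AE x in U. norm ((norm (f x + g x))\<^sup>2) \<le> norm (2 * ((norm (f x))\<^sup>2 + (norm (g x))\<^sup>2))"
      by auto
  qed measurable
  then show ?thesis by (simp add: L2_unit_def)
qed

lemma L2_unit_diff:
  assumes "f \<in> L2_unit" "g \<in> L2_unit"
  shows "(\<lambda>x. f x - g x) \<in> L2_unit"
  using L2_unit_add[OF assms(1) L2_unit_cmult[OF assms(2), of "- 1"]] by simp

lemma L2_unit_sum:
  assumes "\<And>k. k \<in> F \<Longrightarrow> u k \<in> L2_unit"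
  shows "(\<lambda>x. \<Sum>k\<in>F. u k x) \<in> L2_unit"
  using assms
proof (induction F rule: infinite_finite_induct)
  case (insert k F)
  then show ?case by (simp add: L2_unit_add)
qed (auto simp: L2_unit_def)

lemma L2_unit_continuous:
  assumes "continuous_on {0..1} f"
  shows "f \<in> L2_unit"
  unfolding L2_unit_def
  using assms by (auto intro!: continuous_imp_measurable_on_sets_lebesgue
      continuous_imp_integrable_real continuous_intros)

lemma integrable_L2_inner:
  assumes "f \<in> L2_unit" "g \<in> L2_unit"
  shows "integrable U (\<lambda>x. f x * cnj (g x))"
proof (rule Bochner_Integration.integrable_bound)
  note [measurable] = L2_unitD(1)[OF assms(1)] L2_unitD(1)[OF assms(2)]
  show "integrable U (\<lambda>x. (norm (f x))\<^sup>2 + (norm (g x))\<^sup>2)"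
    using L2_unitD(2)[OF assms(1)] L2_unitD(2)[OF assms(2)] by simp
  have "(\<lambda>x. cnj (g x)) \<in> borel_measurable U"
    by (rule measurable_compose[OF L2_unitD(1)[OF assms(2)]])
       (intro borel_measurable_continuous_onI continuous_intros)
  then show "(\<lambda>x. f x * cnj (g x)) \<in> borel_measurable U"
    by measurable
  have "norm (f x) * norm (g x) \<le> (norm (f x))\<^sup>2 + (norm (g x))\<^sup>2" for x
    using sum_squares_bound[of "norm (f x)" "norm (g x)"]
      mult_nonneg_nonneg[OF norm_ge_zero[of "f x"] norm_ge_zero[of "g x"]] by linarith
  then show "AE x in U. norm (f x * cnj (g x)) \<le> norm ((norm (f x))\<^sup>2 + (norm (g x))\<^sup>2)"
    by (simp add: norm_mult)
qed

lemma L2_inner_cnj: "L2_inner g f = cnj (L2_inner f g)"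
  unfolding L2_inner_def by (subst Bochner_Integration.integral_cnj[symmetric]) (simp add: mult.commute)

lemma L2_inner_add_left:
  assumes "f \<in> L2_unit" "g \<in> L2_unit" "h \<in> L2_unit"
  shows "L2_inner (\<lambda>x. f x + g x) h = L2_inner f h + L2_inner g h"
  unfolding L2_inner_def
  using integrable_L2_inner[OF assms(1,3)] integrable_L2_inner[OF assms(2,3)]
  by (simp add: distrib_right)

lemma L2_inner_cmult_left: "L2_inner (\<lambda>x. c * f x) h = c * L2_inner f h"
  unfolding L2_inner_def by (simp add: mult.assoc)

lemma L2_inner_diff_left:
  assumes "f \<in> L2_unit" "g \<in> L2_unit" "h \<in> L2_unit"
  shows "L2_inner (\<lambda>x. f x - g x) h = L2_inner f h - L2_inner g h"
  unfolding L2_inner_def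
  using integrable_L2_inner[OF assms(1,3)] integrable_L2_inner[OF assms(2,3)]
  by (simp add: left_diff_distrib)

lemma L2_inner_sum_left:
  assumes "\<And>k. k \<in> F \<Longrightarrow> u k \<in> L2_unit" "h \<in> L2_unit"
  shows "L2_inner (\<lambda>x. \<Sum>k\<in>F. u k x) h = (\<Sum>k\<in>F. L2_inner (u k) h)"
  unfolding L2_inner_def sum_distrib_right
  using integrable_L2_inner assms by (intro Bochner_Integration.integral_sum) auto

lemma L2_inner_add_right:
  assumes "f \<in> L2_unit" "g \<in> L2_unit" "h \<in> L2_unit"
  shows "L2_inner h (\<lambda>x. f x + g x) = L2_inner h f + L2_inner h g"
  using L2_inner_add_left[OF assms] by (simp add: L2_inner_cnj[of h])

lemma L2_inner_cmult_right: "L2_inner h (\<lambda>x. c * f x) = cnj c * L2_inner h f"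
  using L2_inner_cmult_left[of c f h] by (simp add: L2_inner_cnj[of h])

lemma L2_inner_diff_right:
  assumes "f \<in> L2_unit" "g \<in> L2_unit" "h \<in> L2_unit"
  shows "L2_inner h (\<lambda>x. f x - g x) = L2_inner h f - L2_inner h g"
  using L2_inner_diff_left[OF assms] by (simp add: L2_inner_cnj[of h])

lemma L2_inner_sum_right:
  assumes "\<And>k. k \<in> F \<Longrightarrow> u k \<in> L2_unit" "h \<in> L2_unit"
  shows "L2_inner h (\<lambda>x. \<Sum>k\<in>F. u k x) = (\<Sum>k\<in>F. L2_inner h (u k))"
  using L2_inner_sum_left[of F u h] assms by (simp add: L2_inner_cnj[of h])

lemma L2_norm_nonneg: "0 \<le> L2_norm f"
  by (simp add: L2_norm_def)

lemma L2_inner_self: "L2_inner f f = of_real ((L2_norm f)\<^sup>2)"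
proof -
  have "L2_inner f f = (\<integral>x. of_real ((norm (f x))\<^sup>2) \<partial>U)"
    unfolding L2_inner_def by (simp only: complex_norm_square)
  also have "\<dots> = of_real (\<integral>x. (norm (f x))\<^sup>2 \<partial>U)"
    by (rule integral_complex_of_real)
  finally show ?thesis by (simp add: L2_norm_def)
qed

text \<open>Pythagoras: orthogonality removes the cross terms, so the squared norms add. It is
  applied with \<open>f\<close> the residual of a projection and \<open>g\<close> the gap between
  the projection and a competitor.\<close>

lemma L2_norm_le_add_orthogonal:
  assumes "f \<in> L2_unit" "g \<in> L2_unit" "L2_inner f g = 0"
  shows "L2_norm f \<le> L2_norm (\<lambda>x. f x + g x)"
proof -
  have "L2_inner g f = 0"
    using assms(3) by (simp add: L2_inner_cnj[of g])
  then have "complex_of_real ((L2_norm (\<lambda>x. f x + g x))\<^sup>2) =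
      of_real ((L2_norm f)\<^sup>2 + (L2_norm g)\<^sup>2)"
    using assms by (simp add: L2_inner_self[symmetric] L2_inner_add_left L2_inner_add_right L2_unit_add
        del: of_real_power)
  then have "(L2_norm f)\<^sup>2 \<le> (L2_norm (\<lambda>x. f x + g x))\<^sup>2"
    unfolding of_real_eq_iff by simp
  then show ?thesis
    by (rule power2_le_imp_le[OF _ L2_norm_nonneg])
qed

lemma norm_L2_inner_le_bound:
  assumes "f \<in> L2_unit" "g \<in> L2_unit" "\<And>x. norm (g x) \<le> B"
  shows "norm (L2_inner f g) \<le> B * (\<integral>x. norm (f x) \<partial>U)"
proof -
  \<comment> \<open>Pairing \<open>f\<close> with the constant 1 shows that square-integrability on
    the unit interval implies integrability.\<close>
  have f: "integrable U (\<lambda>x. norm (f x))"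
    using integrable_L2_inner[OF assms(1) L2_unit_continuous[of "\<lambda>_. 1"]] by simp
  have "norm (L2_inner f g) \<le> (\<integral>x. norm (f x * cnj (g x)) \<partial>U)"
    unfolding L2_inner_def by (rule integral_norm_bound)
  also have "\<dots> \<le> (\<integral>x. B * norm (f x) \<partial>U)"
    using integrable_norm[OF integrable_L2_inner[OF assms(1,2)]] f assms(3)
    by (intro integral_mono) (auto simp: norm_mult mult.commute[of B] intro!: mult_left_mono)
  finally show ?thesis by simp
qed

section \<open>The Fourier exponentials\<close>

lemma continuous_on_fourier_exp: "continuous_on S (fourier_exp k)"
  unfolding fourier_exp_def by (intro continuous_intros)

lemma fourier_exp_L2: "fourier_exp k \<in> L2_unit"
  by (intro L2_unit_continuous continuous_on_fourier_exp)

lemma norm_fourier_exp: "norm (fourier_exp k x) = 1"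
proof -
  have "fourier_exp k x = exp (\<i> * of_real (2 * pi * of_int k * x))"
    by (simp add: fourier_exp_def mult_ac)
  then show ?thesis by (simp only: norm_exp_i_times)
qed

text \<open>The integrand collapses to the exponential of index \<open>j - k\<close>. If that index
  is nonzero, the antiderivative \<open>exp (c * x) / c\<close> takes the same value at 0 and 1
  because \<open>exp c = 1\<close>.\<close>

lemma L2_inner_fourier_exp:
  "L2_inner (fourier_exp j) (fourier_exp k) = (if j = k then 1 else 0)"
proof -
  have eq: "fourier_exp j x * cnj (fourier_exp k x) = fourier_exp (j - k) x" for x
    by (simp add: fourier_exp_def exp_cnj flip: exp_add) (simp add: algebra_simps)
  have "L2_inner (fourier_exp j) (fourier_exp k) = (\<integral>x. fourier_exp (j - k) x \<partial>U)"
    by (simp add: L2_inner_def eq)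
  also have "\<dots> = integral {0..1} (fourier_exp (j - k))"
    by (intro lebesgue_integral_eq_integral continuous_imp_integrable continuous_on_fourier_exp)
       (auto simp: continuous_on_fourier_exp intro: continuous_imp_integrable_real)
  also have "\<dots> = (if j = k then 1 else 0)"
  proof (cases "j = k")
    case True
    then show ?thesis by (simp add: fourier_exp_def[abs_def])
  next
    case False
    define c where "c = 2 * of_real pi * \<i> * of_int (j - k)"
    have "c \<noteq> 0" using False by (simp add: c_def)
    have "((\<lambda>x. exp (c * of_real x)) has_integral
        exp (c * of_real 1) / c - exp (c * of_real 0) / c) {0..1}"
      using \<open>c \<noteq> 0\<close>
      by (intro fundamental_theorem_of_calculus)
         (auto intro!: derivative_eq_intros has_vector_derivative_real_field
           simp: field_simps)
    moreover have "exp c = 1"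
      unfolding c_def exp_eq_1 by (auto intro!: exI[of _ "j - k"])
    ultimately have "(fourier_exp (j - k) has_integral 0) {0..1}"
      by (simp add: fourier_exp_def[abs_def] c_def)
    then show ?thesis using False by (simp add: integral_unique)
  qed
  finally show ?thesis .
qed

section \<open>The lacunary series and the Weierstrass exponentials\<close>

definition lacunary :: "real \<Rightarrow> int \<Rightarrow> real \<Rightarrow> complex" where
  "lacunary a k x = (\<Sum>m. of_real a ^ m * fourier_exp (k * 2 ^ m) x)"

lemma weierstrass_exp_lacunary:
  "weierstrass_exp a k x =
     (if k = 0 then 1
      else if odd k then of_real (sqrt (1 - a\<^sup>2)) * lacunary a k x
      else of_real (1 - a\<^sup>2) * lacunary a k x - of_real a * fourier_exp (k div 2) x)"
proof -
  have "exp (of_real pi * \<i> * of_int k * of_real x) = fourier_exp (k div 2) x" if "even k"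
    using that by (auto simp: fourier_exp_def elim!: evenE) (simp add: mult_ac)
  then show ?thesis
    by (simp add: weierstrass_exp_def lacunary_def fourier_exp_def mult_ac)
qed

lemma weierstrass_exp_0: "weierstrass_exp a 0 = fourier_exp 0"
  by (auto simp: weierstrass_exp_def fourier_exp_def)

lemma weierstrass_exp_zero_param: "weierstrass_exp 0 k x = fourier_exp k x"
proof -
  have "lacunary 0 k x = fourier_exp k x"
    \<comment> \<open>Since \<open>0 ^ 0 = 1\<close>, exactly the term \<open>m = 0\<close>
      survives.\<close>
    unfolding lacunary_def by (subst suminf_finite[of "{0}"]) auto
  then show ?thesis
    by (simp add: weierstrass_exp_lacunary) (simp add: fourier_exp_def)
qed

context
  fixes a :: real
  assumes a: "0 \<le> a" "a < 1"
begin

lemma square_lt_1: "a\<^sup>2 < 1"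
  using a by (simp add: power_less_one_iff)

lemma summable_geometric_a: "summable (\<lambda>m. a ^ m)"
  using a by simp

lemma norm_lacunary_term: "norm (of_real a ^ m * fourier_exp j x) \<le> a ^ m"
  using a by (simp add: norm_mult norm_power norm_fourier_exp)

lemma summable_lacunary: "summable (\<lambda>m. of_real a ^ m * fourier_exp (k * 2 ^ m) x)"
  by (rule summable_comparison_test'[OF summable_geometric_a norm_lacunary_term])

lemma norm_lacunary: "norm (lacunary a k x) \<le> 1 / (1 - a)"
proof -
  have "norm (lacunary a k x) \<le> (\<Sum>m. a ^ m)"
    unfolding lacunary_def by (rule norm_suminf_le[OF norm_lacunary_term summable_geometric_a])
  then show ?thesis using a by (simp add: suminf_geometric)
qed

text \<open>The M-test with majorant \<open>a ^ m\<close> gives a uniform limit of continuous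
  partial sums, hence a continuous function.\<close>

lemma lacunary_L2: "lacunary a k \<in> L2_unit"
proof (rule L2_unit_continuous)
  have "uniform_limit {0..1} (\<lambda>n x. \<Sum>m<n. of_real a ^ m * fourier_exp (k * 2 ^ m) x)
      (lacunary a k) sequentially"
    unfolding lacunary_def[abs_def]
    by (rule Weierstrass_m_test[OF norm_lacunary_term summable_geometric_a])
  then show "continuous_on {0..1} (lacunary a k)"
    by (rule uniform_limit_theorem[rotated])
       (auto intro!: always_eventually continuous_intros continuous_on_fourier_exp)
qed

lemma lacunary_rec: "lacunary a k x = fourier_exp k x + of_real a * lacunary a (2 * k) x"
  unfolding lacunary_def
  using suminf_split_head[OF summable_lacunary[of k x]]
    suminf_mult[OF summable_lacunary[of "2 * k" x], of "of_real a"]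
  by (simp add: mult_ac diff_eq_eq add.commute)

lemma fourier_exp_lacunary: "fourier_exp k x = lacunary a k x - of_real a * lacunary a (2 * k) x"
  using lacunary_rec[of k x] by simp

section \<open>Inner products with lacunary series\<close>

lemma sums_L2_inner_lacunary:
  assumes "f \<in> L2_unit"
  shows "(\<lambda>n. of_real a ^ n * L2_inner f (fourier_exp (k * 2 ^ n))) sums L2_inner f (lacunary a k)"
proof -
  \<comment> \<open>Termwise integration by telescoping: the recursion for \<open>lacunary\<close>
    turns the n-th term into \<open>R n - R (Suc n)\<close>, and \<open>R 0\<close> is the claimed
    sum.\<close>
  define R where "R n = of_real a ^ n * L2_inner f (lacunary a (k * 2 ^ n))" for n
  have step: "of_real a ^ n * L2_inner f (fourier_exp (k * 2 ^ n)) = R n - R (Suc n)" for n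
    unfolding fourier_exp_lacunary[abs_def] R_def
    using assms by (simp add: L2_inner_diff_right L2_inner_cmult_right lacunary_L2 L2_unit_cmult
        algebra_simps)
  have "R \<longlonglongrightarrow> 0"
  proof (rule Lim_null_comparison)
    \<comment> \<open>The sup bound \<open>1 / (1 - a)\<close> does not depend on the frequency, so
      one constant serves for all \<open>n\<close>.\<close>
    define C where "C = 1 / (1 - a) * (\<integral>x. norm (f x) \<partial>U)"
    show "\<forall>\<^sub>F n in sequentially. norm (R n) \<le> a ^ n * C"
      unfolding R_def norm_mult norm_power C_def norm_of_real abs_of_nonneg[OF a(1)]
      using norm_L2_inner_le_bound[OF assms lacunary_L2 norm_lacunary] a
      by (intro always_eventually allI mult_left_mono) auto
    show "(\<lambda>n. a ^ n * C) \<longlonglongrightarrow> 0"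
      using a by (intro tendsto_mult_left_zero LIMSEQ_realpow_zero)
  qed
  from telescope_sums'[OF this] show ?thesis
    by (simp add: step R_def)
qed

text \<open>For \<open>k \<noteq> 0\<close> the frequencies \<open>k * 2 ^ m\<close> are pairwise
  distinct, so orthonormality leaves a single term of the series.\<close>

lemma L2_inner_fourier_lacunary:
  assumes "k \<noteq> 0"
  shows "L2_inner (fourier_exp (k * 2 ^ n)) (lacunary a k) = of_real a ^ n"
proof -
  have "(\<lambda>m. if m = n then of_real a ^ m else 0) sums L2_inner (fourier_exp (k * 2 ^ n)) (lacunary a k)"
    using sums_L2_inner_lacunary[OF fourier_exp_L2, of "k * 2 ^ n" k] assms
    by (simp add: L2_inner_fourier_exp if_distrib eq_commute[of n] cong: if_cong)
  then show ?thesis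
    using sums_single sums_unique2 by blast
qed

lemma L2_inner_fourier_lacunary_0:
  assumes "\<And>n. l \<noteq> k * 2 ^ n"
  shows "L2_inner (fourier_exp l) (lacunary a k) = 0"
  using sums_L2_inner_lacunary[OF fourier_exp_L2, of l k] assms
  by (simp add: L2_inner_fourier_exp sums_unique2[OF _ sums_zero])

text \<open>On the common frequencies \<open>k * 2 ^ (m + n)\<close> the two series have
  coefficients \<open>a ^ (m + n)\<close> and \<open>a ^ n\<close>; their products form a geometric
  series with ratio \<open>a\<^sup>2\<close>.\<close>

lemma L2_inner_lacunary_chain:
  assumes "k \<noteq> 0"
  shows "L2_inner (lacunary a k) (lacunary a (k * 2 ^ m)) = of_real (a ^ m / (1 - a\<^sup>2))"
proof -
  have "of_real a ^ n * L2_inner (lacunary a k) (fourier_exp (k * 2 ^ m * 2 ^ n)) =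
      complex_of_real (a ^ m * (a\<^sup>2) ^ n)" for n
    using L2_inner_fourier_lacunary[OF assms, of "m + n"]
    by (simp add: L2_inner_cnj[of "lacunary a k"] power_add mult.assoc power2_eq_square
        power_mult_distrib)
  then have "(\<lambda>n. complex_of_real (a ^ m * (a\<^sup>2) ^ n)) sums
      L2_inner (lacunary a k) (lacunary a (k * 2 ^ m))"
    using sums_L2_inner_lacunary[OF lacunary_L2, of k "k * 2 ^ m"] by simp
  moreover have "(\<lambda>n. complex_of_real (a ^ m * (a\<^sup>2) ^ n)) sums of_real (a ^ m * (1 / (1 - a\<^sup>2)))"
    using square_lt_1 by (intro sums_of_real sums_mult geometric_sums) simp
  ultimately show ?thesis
    by (simp add: sums_unique2)
qed

lemma L2_inner_lacunary_0:
  assumes "\<And>m n. k * 2 ^ m \<noteq> l * 2 ^ n"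
  shows "L2_inner (lacunary a k) (lacunary a l) = 0"
proof -
  have "L2_inner (lacunary a k) (fourier_exp (l * 2 ^ n)) = 0" for n
    using L2_inner_fourier_lacunary_0[OF assms[symmetric]]
    by (simp add: L2_inner_cnj[of "lacunary a k"])
  then show ?thesis
    using sums_L2_inner_lacunary[OF lacunary_L2, of k l] by (simp add: sums_unique2[OF _ sums_zero])
qed

section \<open>Orthonormality of the Weierstrass exponentials\<close>

lemma weierstrass_exp_odd:
  "odd k \<Longrightarrow> weierstrass_exp a k = (\<lambda>x. of_real (sqrt (1 - a\<^sup>2)) * lacunary a k x)"
  by (auto simp: weierstrass_exp_lacunary)

text \<open>Substituting \<open>fourier_exp k = lacunary a k - a * lacunary a (2 * k)\<close> into
  the definition cancels the two multiples of \<open>a\<^sup>2\<close>.\<close>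

lemma weierstrass_exp_even:
  assumes "k \<noteq> 0"
  shows "weierstrass_exp a (2 * k) = (\<lambda>x. lacunary a (2 * k) x - of_real a * lacunary a k x)"
  using assms by (auto simp: weierstrass_exp_lacunary fourier_exp_lacunary algebra_simps power2_eq_square)

lemma weierstrass_exp_L2: "weierstrass_exp a k \<in> L2_unit"
proof -
  consider "k = 0" | "odd k" | j where "k = 2 * j" "j \<noteq> 0"
    by (metis evenE mult_zero_right)
  then show ?thesis
    by cases (simp_all add: weierstrass_exp_0 weierstrass_exp_odd weierstrass_exp_even
        fourier_exp_L2 lacunary_L2 L2_unit_cmult L2_unit_diff)
qed

text \<open>Two cases. If \<open>k\<close> is a proper descendant of \<open>l\<close> under
  doubling, the two contributions \<open>a ^ Suc p\<close> and \<open>a * a ^ p\<close>, both over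
  \<open>1 - a\<^sup>2\<close>, cancel. Otherwise the chains of \<open>k\<close> and
  \<open>l\<close> never meet.\<close>

lemma L2_inner_weierstrass_lacunary_0:
  assumes "k \<noteq> 0" and l: "\<And>n. l \<noteq> k * 2 ^ n"
  shows "L2_inner (weierstrass_exp a k) (lacunary a l) = 0"
proof (cases "\<exists>n. k = l * 2 ^ n")
  case True
  then obtain n where n: "k = l * 2 ^ n" by blast
  \<comment> \<open>The case \<open>n = 0\<close> would mean \<open>l = k\<close>, which
    \<open>l\<close> excludes; hence \<open>k\<close> is even with half
    \<open>l * 2 ^ p\<close>.\<close>
  with l[of 0] obtain p where p: "n = Suc p" by (cases n) auto
  have "l \<noteq> 0" using assms(1) n by auto
  have chain: "L2_inner (lacunary a (l * 2 ^ m)) (lacunary a l) = of_real (a ^ m / (1 - a\<^sup>2))" for m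
    using L2_inner_lacunary_chain[OF \<open>l \<noteq> 0\<close>, of m] by (simp add: L2_inner_cnj[of _ "lacunary a l"])
  have "weierstrass_exp a k =
      (\<lambda>x. lacunary a (l * 2 ^ Suc p) x - of_real a * lacunary a (l * 2 ^ p) x)"
    using weierstrass_exp_even[of "l * 2 ^ p"] \<open>l \<noteq> 0\<close> by (simp add: n p mult_ac)
  then show ?thesis
    by (simp add: L2_inner_diff_left L2_inner_cmult_left lacunary_L2 L2_unit_cmult chain
        del: power_Suc) simp
next
  case False
  \<comment> \<open>Cancelling the smaller power of 2 from a common value would place
    \<open>l\<close> on the chain of \<open>k\<close> or \<open>k\<close> on the chain of
    \<open>l\<close>.\<close>
  have ne: "k * 2 ^ m \<noteq> l * 2 ^ n" for m n
  proof
    assume eq: "k * 2 ^ m = l * 2 ^ n"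
    show False
    proof (cases "n \<le> m")
      case True
      then have "k * 2 ^ (m - n) * 2 ^ n = l * 2 ^ n"
        using eq by (simp add: mult.assoc flip: power_add)
      then show False using l[of "m - n"] by simp
    next
      case le: False
      then have "l * 2 ^ (n - m) * 2 ^ m = k * 2 ^ m"
        using eq by (simp add: mult.assoc flip: power_add)
      then show False using False by auto
    qed
  qed
  show ?thesis
  proof (cases "odd k")
    case True
    then show ?thesis
      by (simp add: weierstrass_exp_odd L2_inner_cmult_left L2_inner_lacunary_0[OF ne])
  next
    case False
    then obtain j where j: "k = 2 * j" by (auto elim: evenE)
    with assms(1) have "j \<noteq> 0" by simp
    have "j * 2 ^ m \<noteq> l * 2 ^ n" for m n
      using ne[of m "Suc n"] by (auto simp: j)
    then show ?thesis
      using \<open>j \<noteq> 0\<close> L2_inner_lacunary_0[OF ne]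
      by (simp add: j weierstrass_exp_even L2_inner_diff_left L2_inner_cmult_left lacunary_L2
          L2_unit_cmult L2_inner_lacunary_0)
  qed
qed

text \<open>For \<open>l \<noteq> 0\<close> the second factor is built from
  \<open>lacunary a l\<close> and, for even \<open>l\<close>, \<open>lacunary a (l div 2)\<close>.
  Half of \<open>l\<close> is not on the forward chain of \<open>k\<close> either, since doubling
  would put \<open>l\<close> there. The constant function at \<open>l = 0\<close> is treated
  separately.\<close>

lemma L2_inner_weierstrass_not_chain:
  assumes "k \<noteq> 0" and l: "\<And>n. l \<noteq> k * 2 ^ n"
  shows "L2_inner (weierstrass_exp a k) (weierstrass_exp a l) = 0"
proof -
  consider "l = 0" | "odd l" | j where "l = 2 * j" "j \<noteq> 0"
    by (metis evenE mult_zero_right)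
  then show ?thesis
  proof cases
    case 1
    have e0: "L2_inner (lacunary a i) (fourier_exp 0) = 0" if "i \<noteq> 0" for i
      using L2_inner_fourier_lacunary_0[of 0 i] that by (simp add: L2_inner_cnj[of "lacunary a i"])
    consider "odd k" | j where "k = 2 * j" "j \<noteq> 0"
      using assms(1) by (metis evenE mult_zero_right)
    then show ?thesis
      by cases (simp_all add: 1 assms(1) weierstrass_exp_0 weierstrass_exp_odd weierstrass_exp_even
          L2_inner_diff_left L2_inner_cmult_left lacunary_L2 L2_unit_cmult fourier_exp_L2 e0)
  next
    case 2
    then show ?thesis
      using L2_inner_weierstrass_lacunary_0[OF assms]
      by (simp add: weierstrass_exp_odd[of l] L2_inner_cmult_right)
  next
    case 3
    have "j \<noteq> k * 2 ^ n" for n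
      using l[of "Suc n"] 3 by auto
    then show ?thesis
      using L2_inner_weierstrass_lacunary_0[OF assms] L2_inner_weierstrass_lacunary_0[OF assms(1), of j] 3
      by (simp add: weierstrass_exp_even L2_inner_diff_right L2_inner_cmult_right lacunary_L2
          L2_unit_cmult weierstrass_exp_L2)
  qed
qed

text \<open>Each lacunary series of nonzero index has squared norm
  \<open>1 / (1 - a\<^sup>2)\<close>, which the factor \<open>sqrt (1 - a\<^sup>2)\<close>
  normalises for odd \<open>k\<close>. For even \<open>k \<noteq> 0\<close>, subtracting the
  component along the preceding series leaves
  \<open>(1 - a\<^sup>2) / (1 - a\<^sup>2)\<close>.\<close>

lemma L2_inner_weierstrass_self: "L2_inner (weierstrass_exp a k) (weierstrass_exp a k) = 1"
proof -
  consider "k = 0" | "odd k" | j where "k = 2 * j" "j \<noteq> 0"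
    by (metis evenE mult_zero_right)
  then show ?thesis
  proof cases
    case 1
    then show ?thesis by (simp add: weierstrass_exp_0 L2_inner_fourier_exp)
  next
    case 2
    then have "k \<noteq> 0" by auto
    from L2_inner_lacunary_chain[OF this, of 0]
    have "L2_inner (weierstrass_exp a k) (weierstrass_exp a k) =
        of_real (sqrt (1 - a\<^sup>2) * sqrt (1 - a\<^sup>2) * (1 / (1 - a\<^sup>2)))"
      unfolding weierstrass_exp_odd[OF 2] L2_inner_cmult_left L2_inner_cmult_right of_real_mult
      by simp
    also have "sqrt (1 - a\<^sup>2) * sqrt (1 - a\<^sup>2) * (1 / (1 - a\<^sup>2)) = 1"
      using square_lt_1 by simp
    finally show ?thesis by simp
  next
    case 3
    have 1: "L2_inner (lacunary a j) (lacunary a j) = of_real (1 / (1 - a\<^sup>2))"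
      using L2_inner_lacunary_chain[OF 3(2), of 0] by simp
    have 2: "L2_inner (lacunary a (2 * j)) (lacunary a (2 * j)) = of_real (1 / (1 - a\<^sup>2))"
      using L2_inner_lacunary_chain[of "2 * j" 0] 3 by simp
    have 5: "L2_inner (lacunary a j) (lacunary a (2 * j)) = of_real (a / (1 - a\<^sup>2))"
      using L2_inner_lacunary_chain[OF 3(2), of 1] by (simp add: mult.commute)
    then have 4: "L2_inner (lacunary a (2 * j)) (lacunary a j) = of_real (a / (1 - a\<^sup>2))"
      by (simp add: L2_inner_cnj[of _ "lacunary a j"])
    have "L2_inner (weierstrass_exp a k) (weierstrass_exp a k) =
        of_real (1 / (1 - a\<^sup>2) - a * (a / (1 - a\<^sup>2)) - a * (a / (1 - a\<^sup>2) - a * (1 / (1 - a\<^sup>2))))"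
      unfolding 3(1) weierstrass_exp_even[OF 3(2)] of_real_diff of_real_mult
      by (simp add: L2_inner_diff_left L2_inner_cmult_left L2_inner_diff_right L2_inner_cmult_right
          lacunary_L2 L2_unit_cmult L2_unit_diff 1 2 5 4)
    also have "1 / (1 - a\<^sup>2) - a * (a / (1 - a\<^sup>2)) - a * (a / (1 - a\<^sup>2) - a * (1 / (1 - a\<^sup>2))) = 1"
      using square_lt_1 by (simp add: field_simps power2_eq_square)
    finally show ?thesis by simp
  qed
qed

lemma L2_inner_weierstrass_exp:
  "L2_inner (weierstrass_exp a k) (weierstrass_exp a l) = (if k = l then 1 else 0)"
proof (cases "k = l")
  case True
  then show ?thesis by (simp add: L2_inner_weierstrass_self)
next
  case ne: False
  show ?thesis
  proof (cases "k \<noteq> 0 \<and> (\<forall>n. l \<noteq> k * 2 ^ n)")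
    case True
    then show ?thesis using ne L2_inner_weierstrass_not_chain[of k l] by auto
  next
    case False
    \<comment> \<open>The roles of \<open>k\<close> and \<open>l\<close> are now exchanged: distinct
      nonzero indices cannot each be a power of 2 times the other, and if \<open>k = 0\<close> then
      \<open>l\<close> is nonzero.\<close>
    have "l \<noteq> 0" using False ne by auto
    moreover have "k \<noteq> l * 2 ^ n" for n
    proof
      assume k: "k = l * 2 ^ n"
      with \<open>l \<noteq> 0\<close> False obtain m where "l = l * (2 ^ n * 2 ^ m)"
        by (auto simp: mult.assoc)
      then have "(2::int) ^ (n + m) = 1" using \<open>l \<noteq> 0\<close> by (simp add: power_add)
      then show False using k ne by simp
    qed
    ultimately have "L2_inner (weierstrass_exp a l) (weierstrass_exp a k) = 0"
      by (rule L2_inner_weierstrass_not_chain)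
    then show ?thesis using ne by (simp add: L2_inner_cnj[of "weierstrass_exp a k"])
  qed
qed

section \<open>Transfer of convergence from Fourier to Weierstrass sums\<close>

lemma fourier_exp_weierstrass_odd:
  assumes "odd k"
  shows "fourier_exp k = (\<lambda>x. of_real (sqrt (1 - a\<^sup>2)) * weierstrass_exp a k x
    - of_real a * weierstrass_exp a (2 * k) x)"
proof
  fix x
  have "k \<noteq> 0" using assms by auto
  \<comment> \<open>The first summand thus becomes \<open>(1 - a\<^sup>2) * lacunary a k\<close>;
    the second contributes \<open>a\<^sup>2 * lacunary a k - a * lacunary a (2 * k)\<close>.\<close>
  have "complex_of_real (sqrt (1 - a\<^sup>2)) * of_real (sqrt (1 - a\<^sup>2)) = of_real (1 - a\<^sup>2)"
    using square_lt_1 by (simp flip: of_real_mult)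
  then show "fourier_exp k x = of_real (sqrt (1 - a\<^sup>2)) * weierstrass_exp a k x
    - of_real a * weierstrass_exp a (2 * k) x"
    using assms \<open>k \<noteq> 0\<close>
    by (simp add: weierstrass_exp_odd weierstrass_exp_even fourier_exp_lacunary flip: mult.assoc)
       (simp add: algebra_simps power2_eq_square)
qed

text \<open>A recursion to half the index: repeated halving ends at an odd index, where the previous
  identity applies.\<close>

lemma fourier_exp_weierstrass_even:
  assumes "k \<noteq> 0"
  shows "fourier_exp (2 * k) = (\<lambda>x. of_real a * fourier_exp k x +
    (weierstrass_exp a (2 * k) x - of_real a * weierstrass_exp a (2 * (2 * k)) x))"
  using assms weierstrass_exp_even[of k] weierstrass_exp_even[of "2 * k"]
  by (auto simp: fourier_exp_lacunary algebra_simps)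

text \<open>Induction on the absolute value of \<open>k\<close> along the halving recursion. The
  bound is doubled because expressing the exponential of index \<open>k\<close> involves the
  Weierstrass exponential of index \<open>2 * k\<close>.\<close>

lemma orthogonal_fourier_exp:
  assumes "h \<in> L2_unit" and h: "\<And>j. \<bar>j\<bar> \<le> 2 * K \<Longrightarrow> L2_inner h (weierstrass_exp a j) = 0"
    and "\<bar>k\<bar> \<le> K"
  shows "L2_inner h (fourier_exp k) = 0"
  using assms(3)
proof (induction "nat \<bar>k\<bar>" arbitrary: k rule: less_induct)
  case less
  consider "k = 0" | "odd k" | j where "k = 2 * j" "j \<noteq> 0"
    by (metis evenE mult_zero_right)
  then show ?case
  proof cases
    case 1
    then show ?thesis using h[of 0] less.prems by (simp add: weierstrass_exp_0)
  next
    case 2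
    then show ?thesis
      using less.prems assms(1) h[of k] h[of "2 * k"]
      by (simp add: fourier_exp_weierstrass_odd L2_inner_diff_right L2_inner_cmult_right
          weierstrass_exp_L2 L2_unit_cmult)
  next
    case 3
    then have "L2_inner h (fourier_exp j) = 0"
      using less.prems by (intro less.hyps) auto
    moreover have "L2_inner h (weierstrass_exp a (2 * j)) = 0"
      "L2_inner h (weierstrass_exp a (2 * (2 * j))) = 0"
      using less.prems 3 by (auto intro!: h)
    ultimately show ?thesis
      unfolding 3(1) fourier_exp_weierstrass_even[OF 3(2)]
      using assms(1)
      by (simp add: L2_inner_diff_right L2_inner_add_right L2_inner_cmult_right
          weierstrass_exp_L2 fourier_exp_L2 L2_unit_cmult L2_unit_diff)
  qed
qed

text \<open>The residual \<open>h\<close> of the projection \<open>p\<close> is orthogonal to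
  \<open>p\<close> and, as \<open>F\<close> is wide enough, to every Fourier polynomial
  \<open>s\<close> of degree at most \<open>K\<close>. Since \<open>f - s = h + (p - s)\<close>,
  Pythagoras applies, whatever the coefficients \<open>c\<close>.\<close>

lemma weierstrass_best_approx:
  assumes f: "f \<in> L2_unit" and "finite F" "{- (2 * int K)..2 * int K} \<subseteq> F"
  shows "L2_norm (\<lambda>x. f x - (\<Sum>k\<in>F. weierstrass_coeff a f k * weierstrass_exp a k x))
    \<le> L2_norm (\<lambda>x. f x - (\<Sum>k = - int K..int K. c k * fourier_exp k x))"
proof -
  define p where "p x = (\<Sum>k\<in>F. weierstrass_coeff a f k * weierstrass_exp a k x)" for x
  define s where "s x = (\<Sum>k = - int K..int K. c k * fourier_exp k x)" for x
  define h where "h x = f x - p x" for x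
  have p: "p \<in> L2_unit"
    unfolding p_def[abs_def] by (intro L2_unit_sum L2_unit_cmult weierstrass_exp_L2)
  have s: "s \<in> L2_unit"
    unfolding s_def[abs_def] by (intro L2_unit_sum L2_unit_cmult fourier_exp_L2)
  have h: "h \<in> L2_unit"
    unfolding h_def[abs_def] by (intro L2_unit_diff f p)
  have h_orth: "L2_inner h (weierstrass_exp a j) = 0" if "j \<in> F" for j
  proof -
    have "L2_inner p (weierstrass_exp a j) = weierstrass_coeff a f j"
      unfolding p_def[abs_def] using that \<open>finite F\<close>
      by (simp add: L2_inner_sum_left L2_inner_cmult_left L2_inner_weierstrass_exp
          L2_unit_cmult weierstrass_exp_L2 if_distrib cong: if_cong)
    then show ?thesis
      unfolding h_def[abs_def]
      by (simp add: L2_inner_diff_left f p weierstrass_exp_L2 weierstrass_coeff_def)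
  qed
  have "L2_inner h p = 0"
    unfolding p_def[abs_def] using h h_orth
    by (simp add: L2_inner_sum_right L2_inner_cmult_right L2_unit_cmult weierstrass_exp_L2)
  moreover have "L2_inner h (fourier_exp k) = 0" if "k \<in> {- int K..int K}" for k
  proof (rule orthogonal_fourier_exp[OF h])
    show "\<bar>k\<bar> \<le> int K" using that by auto
    show "L2_inner h (weierstrass_exp a j) = 0" if "\<bar>j\<bar> \<le> 2 * int K" for j
      using that assms(3) by (intro h_orth subsetD[OF assms(3)]) auto
  qed
  then have "L2_inner h s = 0"
    unfolding s_def[abs_def] using h
    by (simp add: L2_inner_sum_right L2_inner_cmult_right L2_unit_cmult fourier_exp_L2)
  ultimately have "L2_inner h (\<lambda>x. p x - s x) = 0"
    by (simp add: L2_inner_diff_right p s h)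
  from L2_norm_le_add_orthogonal[OF h L2_unit_diff[OF p s] this]
  show ?thesis
    by (simp add: h_def[abs_def] p_def s_def)
qed

lemma has_L2_expansion_weierstrass:
  assumes "has_L2_expansion f c fourier_exp"
  shows "has_L2_expansion f (weierstrass_coeff a f) (weierstrass_exp a)"
proof -
  have f: "f \<in> L2_unit"
    and lim: "((\<lambda>(M, N). L2_norm (\<lambda>x. f x - (\<Sum>k = - int M..int N. c k * fourier_exp k x))) \<longlongrightarrow> 0)
       (sequentially \<times>\<^sub>F sequentially)"
    using assms by (auto simp: has_L2_expansion_def)
  \<comment> \<open>Symmetric Fourier sums suffice as competitors, so the double limit is restricted
    to its diagonal.\<close>
  have "filterlim (\<lambda>K. (K, K)) (sequentially \<times>\<^sub>F sequentially) sequentially"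
    by (intro filterlim_Pair filterlim_ident)
  from filterlim_compose[OF lim this]
  have diag: "(\<lambda>K. L2_norm (\<lambda>x. f x - (\<Sum>k = - int K..int K. c k * fourier_exp k x))) \<longlonglongrightarrow> 0"
    by simp
  have "((\<lambda>(M, N). L2_norm (\<lambda>x. f x -
      (\<Sum>k = - int M..int N. weierstrass_coeff a f k * weierstrass_exp a k x))) \<longlongrightarrow> 0)
       (sequentially \<times>\<^sub>F sequentially)"
  proof (rule tendstoI)
    fix e :: real assume "e > 0"
    from tendstoD[OF diag this] obtain K where
      K: "L2_norm (\<lambda>x. f x - (\<Sum>k = - int K..int K. c k * fourier_exp k x)) < e"
      by (auto simp: eventually_sequentially L2_norm_def)
    \<comment> \<open>A single good \<open>K\<close> controls every window from \<open>- M\<close>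
      to \<open>N\<close> that contains all indices up to \<open>2 * K\<close> in absolute value, so
      \<open>M\<close> and \<open>N\<close> may grow independently.\<close>
    have "dist (L2_norm (\<lambda>x. f x -
        (\<Sum>k = - int M..int N. weierstrass_coeff a f k * weierstrass_exp a k x))) 0 < e"
      if "M \<ge> 2 * K" "N \<ge> 2 * K" for M N
      using weierstrass_best_approx[OF f, of "{- int M..int N}" K c] that K
      by (simp add: L2_norm_nonneg)
    then show "\<forall>\<^sub>F p in sequentially \<times>\<^sub>F sequentially. dist (case p of (M, N) \<Rightarrow> L2_norm (\<lambda>x. f x -
        (\<Sum>k = - int M..int N. weierstrass_coeff a f k * weierstrass_exp a k x))) 0 < e"
      unfolding eventually_prod_filter
      by (intro exI[of _ "\<lambda>n. n \<ge> 2 * K"]) (auto simp: eventually_ge_at_top)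
  qed
  then show ?thesis
    by (simp add: has_L2_expansion_def f weierstrass_exp_L2)
qed

end

theorem theorem2p4:
  fixes a :: real and f :: "real \<Rightarrow> complex"
  assumes "0 \<le> a" and "a < 1"
    and "f \<in> L2_unit"
    and "has_L2_expansion f (fourier_coeff f) fourier_exp"
  shows "has_L2_expansion f (weierstrass_coeff a f) (weierstrass_exp a) \<and>
    (a = 0 \<longrightarrow>
      (\<forall>k. weierstrass_coeff a f k = fourier_coeff f k) \<and>
      (\<forall>k x. weierstrass_exp a k x = fourier_exp k x))"
proof -
  have "weierstrass_exp 0 k = fourier_exp k" for k
    by (rule ext) (rule weierstrass_exp_zero_param)
  then show ?thesis
    using has_L2_expansion_weierstrass[OF assms(1,2,4)]
    by (simp add: weierstrass_coeff_def fourier_coeff_def)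
qed

end
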